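(* Let $q\in(-\infty,0)$ and let $\mu$ be a $\sigma$-finite $q$-homogeneous Borel measure on $\mathbb{R}^n$ supported on the cone $\Sigma$. Let $B\subset\mathbb{R}^n$ be any convex domain containing the origin with $\mu(\mathbb{R}^n\setminus B)\in(0,\infty)$. Assume that for some Borel set $C\subset\mathbb{R}^n$ with $\mu(C)\in(0,\infty)$ we have $$\mu^-_B(C)=-\frac1q\,\mu(\mathbb{R}^n\setminus B)^q\,\mu(C)^{1-q}.$$ Then, up to a set of zero $\mu$-measure, $C\cap\Sigma$ is homothetic to $\Sigma\setminus B$; that is, there exists $m>0$ such that $C\cap\Sigma$ and $m(\Sigma\setminus B)=\Sigma\setminus mB$ differ by a set of zero $\mu$-measure.
   Context: $\mu$ is $q$-homogeneous if $\mu(\lambda A)^q=\lambda\,\mu(A)^q$ (i.e. $\mu(\lambda A)=\lambda^{1/q}\mu(A)$) for every Borel set $A\subset\mathbb{R}^n$ and every $\lambda>0$. $\mu$ is supported on the (Borel) cone $\Sigma$ if $\mu(\mathbb{R}^n\setminus\Sigma)=0$; cone means $\lambda\Sigma=\Sigma$ for all $\lambda>0$. A domain is a (non-empty) open connected set. Inner boundary measure with respect to $B$: $\mu^-_B(C)=\liminf_{\epsilon\to0^+}\frac{\mu((A+\epsilon B)\setminus A)}{\epsilon}$ with $A=\mathbb{R}^n\setminus C$, where $A+\epsilon B$ is the Minkowski sum. *)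

theory Defs
  imports "HOL-Analysis.Analysis"
begin

text \<open>A measure may take the value infinity, so the defining relation
  \<open>\<mu>(\<lambda>A)^q = \<lambda> \<mu>(A)^q\<close> is written in its solved form \<open>\<mu>(\<lambda>A) = \<lambda>^(1/q) \<mu>(A)\<close>, which needs no
  convention for powers of \<open>0\<close> and \<open>\<infinity>\<close>. It is only meant for \<open>q \<noteq> 0\<close>.\<close>

definition q_homogeneous :: "real \<Rightarrow> 'a::real_normed_vector measure \<Rightarrow> bool" where
  "q_homogeneous q M \<longleftrightarrow>
     (\<forall>A\<in>sets borel. \<forall>l>0. emeasure M ((*\<^sub>R) l ` A) = ennreal (l powr (1 / q)) * emeasure M A)"

text \<open>Unlike the library's \<^const>\<open>cone\<close> and \<^const>\<open>conic\<close>, only positive dilations are used, so a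
  cone need not contain the origin.\<close>

definition dilation_cone :: "'a::real_vector set \<Rightarrow> bool" where
  "dilation_cone S \<longleftrightarrow> (\<forall>l>0. (*\<^sub>R) l ` S = S)"

definition supported_on :: "'a measure \<Rightarrow> 'a set \<Rightarrow> bool" where
  "supported_on M S \<longleftrightarrow> emeasure M (UNIV - S) = 0"

definition domain_set :: "'a::topological_space set \<Rightarrow> bool" where
  "domain_set B \<longleftrightarrow> B \<noteq> {} \<and> open B \<and> connected B"

text \<open>The sum of sets is the Minkowski sum from \<^theory>\<open>HOL-Library.Set_Algebras\<close>; it is open, hence
  measurable, when \<open>B\<close> is open.\<close>

definition inner_boundary_measure ::
    "'a::real_normed_vector measure \<Rightarrow> 'a set \<Rightarrow> 'a set \<Rightarrow> ennreal" where
  "inner_boundary_measure M B C =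
     (let A = UNIV - C in
      Liminf (at_right 0) (\<lambda>\<epsilon>. emeasure M ((A + (*\<^sub>R) \<epsilon> ` B) - A) / ennreal \<epsilon>))"

end

(* Let N be the gauge of B and p = -1/q > 0, so that mu has density r powr (-p-1) along each ray.
   With A the complement of C, every point x of C' = C - (A + eps B) satisfies x - eps B <= C, so the
   radial shift x - (eps / N x) x sends C' into C.  Its Jacobian gives
   mu C' + (p+1) eps * (integral of 1/N over C') <= mu C, hence
   (p+1) * (integral of 1/N over C) is at most the boundary measure of C.
   Among sets of mass mu C the integral of 1/N is smallest exactly for the superlevel set
   {N >= m} = UNIV - mB of that mass (bathtub principle), and for it (p+1) times the integral is the
   prescribed boundary measure. *)

theory Submission
  imports Defs
begin

section \<open>The gauge of an open convex neighbourhood of the origin\<close>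

lemma scaleR_image_iff:
  fixes x :: "'a::real_vector"
  assumes "t > 0"
  shows "x \<in> (*\<^sub>R) t ` B \<longleftrightarrow> (1 / t) *\<^sub>R x \<in> B"
proof
  assume "x \<in> (*\<^sub>R) t ` B"
  then show "(1 / t) *\<^sub>R x \<in> B" using assms by auto
next
  assume "(1 / t) *\<^sub>R x \<in> B"
  moreover have "x = t *\<^sub>R ((1 / t) *\<^sub>R x)" using assms by simp
  ultimately show "x \<in> (*\<^sub>R) t ` B" by blast
qed

text \<open>The Minkowski functional of \<open>B\<close>. For open convex \<open>B\<close> around
  the origin it vanishes along every half-line from the origin contained in \<open>B\<close>, so
  divisions by it later need a guard.\<close>

definition gauge_of :: "'a::real_vector set \<Rightarrow> 'a \<Rightarrow> real" where
  "gauge_of B x = Inf {t. t > 0 \<and> x \<in> (*\<^sub>R) t ` B}"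

text \<open>The point \<open>x / t\<close> lies on the segment from the origin to
  \<open>x / s\<close>.\<close>

lemma convex_scale_mono:
  fixes B :: "'a::real_vector set"
  assumes "convex B" "0 \<in> B" "0 < s" "s \<le> t"
  shows "(*\<^sub>R) s ` B \<subseteq> (*\<^sub>R) t ` B"
proof
  fix x assume "x \<in> (*\<^sub>R) s ` B"
  then have "(1 / s) *\<^sub>R x \<in> B" using scaleR_image_iff[OF assms(3), of x B] by simp
  then have "(s / t) *\<^sub>R ((1 / s) *\<^sub>R x) + (1 - s / t) *\<^sub>R 0 \<in> B"
    using assms by (intro convexD) (auto simp: field_simps)
  then have "(1 / t) *\<^sub>R x \<in> B" using assms by simp
  then show "x \<in> (*\<^sub>R) t ` B" using scaleR_image_iff[of t x B] assms by linarith
qed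

context
  fixes B :: "'a::real_normed_vector set"
  assumes B: "open B" "convex B" "0 \<in> B"
begin

text \<open>Openness accounts for the strict inequality: if \<open>x / t\<close> is in
  \<open>B\<close>, then so is \<open>x / s\<close> for some \<open>s < t\<close>. The other
  direction is monotonicity of the dilates.\<close>

lemma gauge_of_lt_iff:
  assumes "t > 0"
  shows "gauge_of B x < t \<longleftrightarrow> x \<in> (*\<^sub>R) t ` B"
proof
  let ?S = "{t. t > 0 \<and> x \<in> (*\<^sub>R) t ` B}"
  have bdd: "bdd_below ?S" by (rule bdd_belowI[of _ 0]) auto
  \<comment> \<open>These points tend to the origin, hence enter \<open>B\<close>: the infimum is
    taken over a non-empty set.\<close>
  have "((\<lambda>t. (1 / t) *\<^sub>R x) \<longlongrightarrow> 0 *\<^sub>R x) at_top"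
    by (intro tendsto_intros tendsto_divide_0[OF tendsto_const] filterlim_at_top_imp_at_infinity filterlim_ident)
  then have "eventually (\<lambda>t. (1 / t) *\<^sub>R x \<in> B) at_top"
    using B by (auto dest: topological_tendstoD)
  then have "eventually (\<lambda>t::real. (1 / t) *\<^sub>R x \<in> B \<and> t > 0) at_top"
    by (intro eventually_conj eventually_gt_at_top)
  then obtain t0 :: real where "(1 / t0) *\<^sub>R x \<in> B" "t0 > 0"
    using eventually_happens'[OF trivial_limit_at_top_linorder] by blast
  then have "t0 \<in> ?S" using scaleR_image_iff[of t0 x B] by simp
  then have ne: "?S \<noteq> {}" by blast
  show "x \<in> (*\<^sub>R) t ` B" if lt: "gauge_of B x < t"
  proof -
    obtain s where "s \<in> ?S" "s < t"
      using lt cInf_lessD[OF ne] unfolding gauge_of_def by blast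
    then show ?thesis using convex_scale_mono[OF B(2,3), of s t] by auto
  qed
  show "gauge_of B x < t" if "x \<in> (*\<^sub>R) t ` B"
  proof -
    have "((\<lambda>s. (1 / s) *\<^sub>R x) \<longlongrightarrow> (1 / t) *\<^sub>R x) (at_left t)"
      using assms by (intro tendsto_intros) auto
    moreover have "(1 / t) *\<^sub>R x \<in> B" using that scaleR_image_iff[OF assms, of x B] by simp
    ultimately have "eventually (\<lambda>s. (1 / s) *\<^sub>R x \<in> B) (at_left t)"
      using B topological_tendstoD by blast
    moreover have "eventually (\<lambda>s. s \<in> {0<..<t}) (at_left t)"
      using assms by (intro eventually_at_leftI[of 0]) auto
    ultimately have "eventually (\<lambda>s. (1 / s) *\<^sub>R x \<in> B \<and> s \<in> {0<..<t}) (at_left t)"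
      by (rule eventually_conj)
    then obtain s where s: "(1 / s) *\<^sub>R x \<in> B" "s \<in> {0<..<t}"
      using eventually_happens'[OF trivial_limit_at_left_real] by blast
    then have "s \<in> ?S" using scaleR_image_iff[of s x B] by auto
    then have "gauge_of B x \<le> s" unfolding gauge_of_def using bdd by (rule cInf_lower)
    then show ?thesis using s by auto
  qed
qed

lemma gauge_of_nonneg: "gauge_of B x \<ge> 0"
proof (rule ccontr)
  assume neg: "\<not> gauge_of B x \<ge> 0"
  have "gauge_of B x < 1" using neg by simp
  then have "x \<in> (*\<^sub>R) 1 ` B" using gauge_of_lt_iff[of 1 x] by linarith
  then have "{t. t > 0 \<and> x \<in> (*\<^sub>R) t ` B} \<noteq> {}" by (intro ex_in_conv[THEN iffD1] exI[of _ 1]) simp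
  then have "0 \<le> gauge_of B x" unfolding gauge_of_def by (rule cInf_greatest) auto
  then show False using neg by simp
qed

lemma gauge_of_scaleR:
  assumes "l > 0"
  shows "gauge_of B (l *\<^sub>R x) = l * gauge_of B x"
proof -
  have lt: "gauge_of B (l *\<^sub>R x) < l * t \<longleftrightarrow> gauge_of B x < t" if "t > 0" for t
    using that assms by (simp add: gauge_of_lt_iff scaleR_image_iff)
  show ?thesis
  proof (rule antisym; rule dense_ge)
    fix z assume z: "l * gauge_of B x < z"
    then have "gauge_of B x < z / l" using assms by (simp add: field_simps)
    moreover from this have "z / l > 0" using gauge_of_nonneg[of x] by linarith
    ultimately show "gauge_of B (l *\<^sub>R x) \<le> z" using lt[of "z / l"] assms by simp
  next
    fix z assume z: "gauge_of B (l *\<^sub>R x) < z"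
    then have "z > 0" using gauge_of_nonneg[of "l *\<^sub>R x"] by linarith
    then have "gauge_of B x < z / l" using lt[of "z / l"] assms z by simp
    then show "l * gauge_of B x \<le> z" using assms by (simp add: field_simps)
  qed
qed

lemma gauge_of_measurable [measurable]: "gauge_of B \<in> borel_measurable borel"
proof (rule borel_measurableI_less)
  fix t
  have "{x. gauge_of B x < t} = (if t > 0 then (*\<^sub>R) t ` B else {})"
    using gauge_of_lt_iff gauge_of_nonneg by (auto simp: not_less intro: order_trans)
  moreover have "open ((*\<^sub>R) t ` B)" if "t > 0" using that B by (intro open_scaling) auto
  ultimately show "{x \<in> space borel. gauge_of B x < t} \<in> sets borel" by simp
qed

end

section \<open>Power functions on the half-line\<close>

text \<open>Serves with \<open>s = p\<close> for the mass of the tail of a ray and with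
  \<open>s = p + 1\<close> for the integral of \<open>1 / N\<close> over that tail.\<close>

lemma nn_integral_powr_tail:
  fixes s c :: real
  assumes "s > 0" "c > 0"
  shows "(\<integral>\<^sup>+r. ennreal (r powr (- s - 1)) * indicator {c..} r \<partial>lborel) = ennreal (c powr (- s) / s)"
proof -
  have "(\<integral>\<^sup>+r. ennreal (r powr (- s - 1)) * indicator {c..} r \<partial>lborel)
      = ennreal (0 - (- (c powr (- s) / s)))"
  proof (rule nn_integral_FTC_atLeast[where F="\<lambda>r. - (r powr (- s) / s)"])
    show "((\<lambda>r. - (r powr (- s) / s)) has_real_derivative r powr (- s - 1)) (at r)" if "c \<le> r" for r
      using that assms by (auto intro!: derivative_eq_intros)
    show "((\<lambda>r. - (r powr (- s) / s)) \<longlongrightarrow> 0) at_top"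
      using tendsto_minus[OF tendsto_divide[OF tendsto_neg_powr[of "- s", OF _ filterlim_ident] tendsto_const[of s]]]
        assms by simp
  qed auto
  then show ?thesis by simp
qed

text \<open>With \<open>u = b / r\<close> the claim reduces to
  \<open>1 + (p + 1) * u \<le> (1 - u) powr (- p - 1)\<close>. Writing the power as an exponential,
  this follows from \<open>- ln (1 - u) \<ge> u\<close> and
  \<open>exp z \<ge> 1 + z\<close>.\<close>

lemma powr_shift_bernoulli:
  fixes p r b :: real
  assumes "p > 0" "0 \<le> b" "b < r"
  shows "r powr (- p - 1) * (1 + (p + 1) * (b / r)) \<le> (r - b) powr (- p - 1)"
proof -
  define u where "u = b / r"
  have u: "0 \<le> u" "u < 1" using assms by (auto simp: u_def)
  have "(p + 1) * u \<le> (- p - 1) * ln (1 - u)"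
    using mult_left_mono[of u "- ln (1 - u)" "p + 1"] ln_le_minus_one[of "1 - u"] u assms
    by (simp add: algebra_simps)
  then have "1 + (p + 1) * u \<le> exp ((- p - 1) * ln (1 - u))"
    using exp_ge_add_one_self[of "(- p - 1) * ln (1 - u)"] by linarith
  also have "\<dots> = (1 - u) powr (- p - 1)" using u by (simp add: powr_def)
  finally have "r powr (- p - 1) * (1 + (p + 1) * u) \<le> r powr (- p - 1) * (1 - u) powr (- p - 1)"
    by (rule mult_left_mono) simp
  also have "\<dots> = (r * (1 - u)) powr (- p - 1)"
    using assms u by (simp add: powr_mult)
  also have "r * (1 - u) = r - b" using assms by (simp add: u_def field_simps)
  finally show ?thesis by (simp add: u_def)
qed

section \<open>Integration along rays for a homogeneous measure\<close>

text \<open>Here \<open>p\<close> stands for \<open>-1/q\<close>, and the gauge is abstracted to a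
  measurable, non-negative, positively homogeneous function, which is what integration along rays
  requires.\<close>

locale homogeneous_measure = sigma_finite_measure M
  for M :: "'a::euclidean_space measure" +
  fixes p :: real and N :: "'a \<Rightarrow> real"
  assumes sets_M [measurable_cong]: "sets M = sets borel"
    and p_pos: "p > 0"
    and emeasure_scale: "\<And>A l. A \<in> sets borel \<Longrightarrow> l > 0 \<Longrightarrow>
          emeasure M ((*\<^sub>R) l ` A) = ennreal (l powr (- p)) * emeasure M A"
    and N_measurable [measurable]: "N \<in> borel_measurable borel"
    and N_nonneg: "\<And>x. N x \<ge> 0"
    and N_scale: "\<And>l x. l > 0 \<Longrightarrow> N (l *\<^sub>R x) = l * N x"
begin

lemma space_M: "space M = UNIV"
  using sets_eq_imp_space_eq[OF sets_M] by simp

text \<open>The push-forward of \<open>M\<close> under dilation by \<open>l\<close> is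
  \<open>l powr p\<close> times \<open>M\<close>, because the preimage of a set is its dilate by
  \<open>1 / l\<close>.\<close>

lemma nn_integral_scale:
  assumes [measurable]: "f \<in> borel_measurable borel" and l: "l > 0"
  shows "(\<integral>\<^sup>+x. f x \<partial>M) = ennreal (l powr (- p)) * (\<integral>\<^sup>+x. f (l *\<^sub>R x) \<partial>M)"
proof -
  have "distr M borel ((*\<^sub>R) l) = scale_measure (ennreal (l powr p)) M"
  proof (rule measure_eqI)
    fix A assume "A \<in> sets (distr M borel ((*\<^sub>R) l))"
    then have [measurable]: "A \<in> sets borel" by simp
    have vimage: "(*\<^sub>R) l -` A = (*\<^sub>R) (1 / l) ` A"
      using l scaleR_image_iff[of "1 / l" _ A] by auto
    have "emeasure (distr M borel ((*\<^sub>R) l)) A = emeasure M ((*\<^sub>R) (1 / l) ` A)"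
      by (simp add: emeasure_distr space_M vimage)
    also have "\<dots> = ennreal (l powr p) * emeasure M A"
      using emeasure_scale[of A "1 / l"] l by (simp add: powr_divide powr_minus_divide)
    finally show "emeasure (distr M borel ((*\<^sub>R) l)) A = emeasure (scale_measure (ennreal (l powr p)) M) A"
      by simp
  qed (simp add: sets_M)
  then have "(\<integral>\<^sup>+x. f x \<partial>distr M borel ((*\<^sub>R) l)) = (\<integral>\<^sup>+x. f x \<partial>scale_measure (ennreal (l powr p)) M)"
    by simp
  then have "(\<integral>\<^sup>+x. f (l *\<^sub>R x) \<partial>M) = ennreal (l powr p) * (\<integral>\<^sup>+x. f x \<partial>M)"
    by (simp add: nn_integral_distr nn_integral_scale_measure)
  then have "ennreal (l powr (- p)) * (\<integral>\<^sup>+x. f (l *\<^sub>R x) \<partial>M)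
      = (ennreal (l powr (- p)) * ennreal (l powr p)) * (\<integral>\<^sup>+x. f x \<partial>M)"
    by (simp add: mult.assoc)
  also have "ennreal (l powr (- p)) * ennreal (l powr p) = 1"
    using l by (simp flip: ennreal_mult powr_add)
  finally show ?thesis by simp
qed

definition shell_weight :: "'a \<Rightarrow> ennreal" where
  "shell_weight y = ennreal (2 / N y) * indicator {1..2} (N y)"

lemma shell_weight_measurable [measurable]: "shell_weight \<in> borel_measurable borel"
  unfolding shell_weight_def by measurable

text \<open>The rays are parametrised by all points of the shell \<open>1 \<le> N y \<le> 2\<close> instead of a single level
  set. Each ray meets the shell in a set of constant weight
  \<open>\<integral> shell_weight (x / r) / r dr = 1\<close>, so that Fubini and homogeneity suffice.\<close>
lemma nn_integral_rays:
  assumes [measurable]: "f \<in> borel_measurable borel" and f0: "\<And>x. N x = 0 \<Longrightarrow> f x = 0"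
  shows "(\<integral>\<^sup>+x. f x \<partial>M) =
    (\<integral>\<^sup>+y. shell_weight y * (\<integral>\<^sup>+r. f (r *\<^sub>R y) * (ennreal (r powr (- p - 1)) * indicator {0<..} r) \<partial>lborel) \<partial>M)"
proof -
  interpret P: pair_sigma_finite M lborel ..
  let ?g = "\<lambda>x r. f x * (ennreal (2 / N x) * indicator {1..2} (N x / r) * indicator {0<..} r)"
  let ?h = "\<lambda>r y. shell_weight y * (f (r *\<^sub>R y) * (ennreal (r powr (- p - 1)) * indicator {0<..} r))"
  \<comment> \<open>The radii with \<open>1 \<le> N x / r \<le> 2\<close> fill an interval of length
    \<open>N x / 2\<close>, so the factor \<open>2 / N x\<close> normalises the weight to total mass
    1. Where \<open>N x = 0\<close> no radius reaches the shell, and \<open>f\<close> vanishes by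
    hypothesis.\<close>
  have inner: "(\<integral>\<^sup>+r. ?g x r \<partial>lborel) = f x" for x
  proof (cases "N x = 0")
    case False
    then have pos: "N x > 0" using N_nonneg[of x] by simp
    have "(\<integral>\<^sup>+r. ?g x r \<partial>lborel) = (\<integral>\<^sup>+r. f x * ennreal (2 / N x) * indicator {N x / 2..N x} r \<partial>lborel)"
      using pos by (intro nn_integral_cong) (auto simp: indicator_def field_simps)
    also have "\<dots> = f x * (ennreal (2 / N x) * ennreal (N x / 2))"
      using pos by (simp add: nn_integral_cmult mult.assoc)
    also have "ennreal (2 / N x) * ennreal (N x / 2) = 1"
      using pos by (simp flip: ennreal_mult)
    finally show ?thesis by simp
  qed (simp add: f0)
  \<comment> \<open>Substitution \<open>x = r y\<close> at fixed \<open>r\<close>: homogeneity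
    contributes \<open>r powr (- p)\<close> and the weight \<open>2 / N x\<close> contributes
    \<open>1 / r\<close>, which together form the radial density.\<close>
  have outer: "(\<integral>\<^sup>+x. ?g x r \<partial>M) = (\<integral>\<^sup>+y. ?h r y \<partial>M)" for r
  proof (cases "r > 0")
    case True
    have "(\<integral>\<^sup>+x. ?g x r \<partial>M) = ennreal (r powr (- p)) * (\<integral>\<^sup>+y. ?g (r *\<^sub>R y) r \<partial>M)"
      using True by (intro nn_integral_scale) auto
    also have "\<dots> = (\<integral>\<^sup>+y. ennreal (r powr (- p)) * ?g (r *\<^sub>R y) r \<partial>M)"
      by (rule nn_integral_cmult[symmetric]) measurable
    also have "\<dots> = (\<integral>\<^sup>+y. ?h r y \<partial>M)"
    proof (rule nn_integral_cong)
      fix y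
      have "ennreal (r powr (- p)) * ennreal (2 / (r * N y)) = ennreal (2 / N y) * ennreal (r powr (- p - 1))"
        using True N_nonneg[of y] by (simp add: powr_diff mult_ac flip: ennreal_mult)
      then have "f (r *\<^sub>R y) * (ennreal (r powr (- p)) * ennreal (2 / (r * N y))) * indicator {1..2} (N y)
          = f (r *\<^sub>R y) * (ennreal (2 / N y) * ennreal (r powr (- p - 1))) * indicator {1..2} (N y)" by simp
      then show "ennreal (r powr (- p)) * ?g (r *\<^sub>R y) r = ?h r y"
        using True by (simp add: N_scale shell_weight_def mult_ac)
    qed
    finally show ?thesis .
  qed simp
  \<comment> \<open>Insert the weight, exchange the integrals, substitute at fixed \<open>r\<close>,
    and exchange back.\<close>
  have "(\<integral>\<^sup>+x. f x \<partial>M) = (\<integral>\<^sup>+x. \<integral>\<^sup>+r. ?g x r \<partial>lborel \<partial>M)" by (simp add: inner)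
  also have "\<dots> = (\<integral>\<^sup>+r. \<integral>\<^sup>+x. ?g x r \<partial>M \<partial>lborel)"
    by (rule P.Fubini'[symmetric]) measurable
  also have "\<dots> = (\<integral>\<^sup>+r. \<integral>\<^sup>+y. ?h r y \<partial>M \<partial>lborel)" by (simp add: outer)
  also have "\<dots> = (\<integral>\<^sup>+y. \<integral>\<^sup>+r. ?h r y \<partial>lborel \<partial>M)"
    by (rule P.Fubini') measurable
  also have "\<dots> = (\<integral>\<^sup>+y. shell_weight y * (\<integral>\<^sup>+r. f (r *\<^sub>R y) * (ennreal (r powr (- p - 1)) * indicator {0<..} r) \<partial>lborel) \<partial>M)"
    by (intro nn_integral_cong nn_integral_cmult) measurable
  finally show ?thesis .
qed

text \<open>The weight is zero where \<open>N y = 0\<close>, so ray integrals need comparison only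
  on rays with positive gauge.\<close>

lemma shell_weight_mult_cong:
  "(N y > 0 \<Longrightarrow> a = b) \<Longrightarrow> shell_weight y * a = shell_weight y * b"
  by (cases "N y > 0") (auto simp: shell_weight_def)

lemma shell_weight_mult_mono:
  "(N y > 0 \<Longrightarrow> a \<le> b) \<Longrightarrow> shell_weight y * a \<le> shell_weight y * b"
  by (cases "N y > 0") (auto simp: shell_weight_def intro!: mult_left_mono)

section \<open>Level sets, radial shifts and the bathtub inequality\<close>

text \<open>A ray with positive gauge meets the level set at the single radius
  \<open>m / N y\<close>, a Lebesgue null set.\<close>

lemma emeasure_level_set:
  assumes "m > 0"
  shows "emeasure M {x. N x = m} = 0"
proof -
  have "emeasure M {x. N x = m} = (\<integral>\<^sup>+x. indicator {x. N x = m} x \<partial>M)" by simp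
  also have "\<dots> = (\<integral>\<^sup>+y. shell_weight y * (\<integral>\<^sup>+r. indicator {x. N x = m} (r *\<^sub>R y) * (ennreal (r powr (- p - 1)) * indicator {0<..} r) \<partial>lborel) \<partial>M)"
    using assms by (intro nn_integral_rays) auto
  also have "\<dots> = (\<integral>\<^sup>+y. shell_weight y * 0 \<partial>M)"
  proof (intro nn_integral_cong shell_weight_mult_cong)
    fix y assume y: "N y > 0"
    have "AE r in lborel. r \<noteq> m / N y" by (rule AE_lborel_singleton)
    then have "AE r in lborel. indicator {x. N x = m} (r *\<^sub>R y) * (ennreal (r powr (- p - 1)) * indicator {0<..} r) = 0"
      by eventually_elim (use y in \<open>auto simp: indicator_def N_scale field_simps\<close>)
    then show "(\<integral>\<^sup>+r. indicator {x. N x = m} (r *\<^sub>R y) * (ennreal (r powr (- p - 1)) * indicator {0<..} r) \<partial>lborel) = 0"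
      by (subst nn_integral_0_iff_AE) (simp_all del: mult_eq_0_iff)
  qed
  finally show ?thesis by simp
qed

text \<open>The ray through \<open>y\<close> enters the superlevel set at
  \<open>c = m / N y\<close>. Its mass there is \<open>c powr (- p) / p\<close>, and the integral of
  \<open>1 / N\<close> is \<open>c powr (- (p + 1)) / ((p + 1) * N y)\<close>. Since
  \<open>c * N y = m\<close>, the ratio of the two is the same on every ray.\<close>

lemma nn_integral_inverse_N_tail:
  assumes m: "m > 0"
  shows "(\<integral>\<^sup>+x. ennreal (1 / N x) * indicator {x. N x \<ge> m} x \<partial>M)
    = ennreal (p / ((p + 1) * m)) * emeasure M {x. N x \<ge> m}"
proof -
  let ?E = "{x. N x \<ge> m}"
  let ?I = "\<lambda>y. \<integral>\<^sup>+r. indicator ?E (r *\<^sub>R y) * (ennreal (r powr (- p - 1)) * indicator {0<..} r) \<partial>lborel"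
  have "(\<integral>\<^sup>+x. ennreal (1 / N x) * indicator ?E x \<partial>M)
     = (\<integral>\<^sup>+y. shell_weight y * (\<integral>\<^sup>+r. (ennreal (1 / N (r *\<^sub>R y)) * indicator ?E (r *\<^sub>R y)) * (ennreal (r powr (- p - 1)) * indicator {0<..} r) \<partial>lborel) \<partial>M)"
    using m by (intro nn_integral_rays) auto
  also have "\<dots> = (\<integral>\<^sup>+y. shell_weight y * (ennreal (p / ((p + 1) * m)) * ?I y) \<partial>M)"
  proof (intro nn_integral_cong shell_weight_mult_cong)
    fix y assume y: "N y > 0"
    define c where "c = m / N y"
    have c: "c > 0" using y m by (simp add: c_def)
    have "?I y = (\<integral>\<^sup>+r. ennreal (r powr (- p - 1)) * indicator {c..} r \<partial>lborel)"
    proof (rule nn_integral_cong)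
      fix r :: real
      have "m \<le> r * N y \<longleftrightarrow> c \<le> r" using y by (simp add: c_def field_simps)
      then show "indicator ?E (r *\<^sub>R y) * (ennreal (r powr (- p - 1)) * indicator {0<..} r)
          = ennreal (r powr (- p - 1)) * indicator {c..} r"
        using c by (cases "r > 0") (auto simp: indicator_def N_scale)
    qed
    then have I: "?I y = ennreal (c powr (- p) / p)"
      using nn_integral_powr_tail[OF p_pos c] by simp
    have "(\<integral>\<^sup>+r. (ennreal (1 / N (r *\<^sub>R y)) * indicator ?E (r *\<^sub>R y)) * (ennreal (r powr (- p - 1)) * indicator {0<..} r) \<partial>lborel)
      = (\<integral>\<^sup>+r. ennreal (1 / N y) * (ennreal (r powr (- (p + 1) - 1)) * indicator {c..} r) \<partial>lborel)"
    proof (rule nn_integral_cong)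
      fix r :: real
      show "(ennreal (1 / N (r *\<^sub>R y)) * indicator ?E (r *\<^sub>R y)) * (ennreal (r powr (- p - 1)) * indicator {0<..} r)
        = ennreal (1 / N y) * (ennreal (r powr (- (p + 1) - 1)) * indicator {c..} r)"
      proof (cases "r > 0")
        case True
        have "r powr (- (p + 1) - 1) = r powr (- p - 1) / r"
          using True powr_diff[of r "- p - 1" 1] by simp
        moreover have "m \<le> r * N y \<longleftrightarrow> c \<le> r" using y by (simp add: c_def field_simps)
        ultimately show ?thesis
          using True y by (auto simp: N_scale indicator_def simp flip: ennreal_mult)
      next
        case False
        then show ?thesis using c by (auto simp: indicator_def)
      qed
    qed
    also have "\<dots> = ennreal (1 / N y) * ennreal (c powr (- (p + 1)) / (p + 1))"
      using nn_integral_powr_tail[of "p + 1" c] p_pos c by (simp add: nn_integral_cmult)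
    also have "\<dots> = ennreal (1 / N y * (c powr (- (p + 1)) / (p + 1)))"
      using p_pos y by (simp flip: ennreal_mult)
    also have "1 / N y * (c powr (- (p + 1)) / (p + 1)) = p / ((p + 1) * m) * (c powr (- p) / p)"
    proof -
      have "c powr (- (p + 1)) = c powr (- p) / c"
        using c powr_diff[of c "- p" 1] by simp
      moreover have "p + 1 \<noteq> 0" "p \<noteq> 0" "m = c * N y" using p_pos y by (auto simp: c_def)
      ultimately show ?thesis using y c by simp
    qed
    also have "ennreal (p / ((p + 1) * m) * (c powr (- p) / p)) = ennreal (p / ((p + 1) * m)) * ?I y"
      using p_pos m by (simp add: I flip: ennreal_mult)
    finally show "(\<integral>\<^sup>+r. (ennreal (1 / N (r *\<^sub>R y)) * indicator ?E (r *\<^sub>R y)) * (ennreal (r powr (- p - 1)) * indicator {0<..} r) \<partial>lborel)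
      = ennreal (p / ((p + 1) * m)) * ?I y" .
  qed
  also have "\<dots> = (\<integral>\<^sup>+y. ennreal (p / ((p + 1) * m)) * (shell_weight y * ?I y) \<partial>M)"
    by (simp add: mult_ac)
  also have "\<dots> = ennreal (p / ((p + 1) * m)) * (\<integral>\<^sup>+y. shell_weight y * ?I y \<partial>M)"
    by (rule nn_integral_cmult) measurable
  also have "(\<integral>\<^sup>+y. shell_weight y * ?I y \<partial>M) = (\<integral>\<^sup>+x. indicator ?E x \<partial>M)"
    using m by (intro nn_integral_rays[symmetric]) auto
  finally show ?thesis by simp
qed

text \<open>The radial shift \<open>x \<mapsto> x - (a / N x) x\<close> is a translation by \<open>a / N y\<close> on the ray through \<open>y\<close>;
  its Jacobian \<open>(1 - a / N x) powr (- p - 1)\<close> is at least \<open>1 + (p + 1) a / N x\<close>.\<close>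
lemma radial_shift_bound:
  assumes [measurable]: "C \<in> sets borel" "C' \<in> sets borel" and a: "a \<ge> 0"
    and gt: "\<And>x. x \<in> C' \<Longrightarrow> N x > a"
    and shift: "\<And>x. x \<in> C' \<Longrightarrow> x - (a / N x) *\<^sub>R x \<in> C"
  shows "(\<integral>\<^sup>+x. ennreal (1 + (p + 1) * a / N x) * indicator C' x \<partial>M) \<le> emeasure M C"
proof -
  let ?J = "\<lambda>x. ennreal (1 + (p + 1) * a / N x) * indicator C' x"
  \<comment> \<open>Removing the zeros of \<open>N\<close> from \<open>C\<close> makes the indicator
    eligible for \<open>nn_integral_rays\<close>.\<close>
  let ?C = "C \<inter> {x. N x > 0}"
  let ?k = "\<lambda>r. ennreal (r powr (- p - 1)) * indicator {0<..} r"
  have "(\<integral>\<^sup>+x. ?J x \<partial>M) = (\<integral>\<^sup>+y. shell_weight y * (\<integral>\<^sup>+r. ?J (r *\<^sub>R y) * ?k r \<partial>lborel) \<partial>M)"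
    using gt a by (intro nn_integral_rays) (force simp: indicator_def)+
  also have "\<dots> \<le> (\<integral>\<^sup>+y. shell_weight y * (\<integral>\<^sup>+r. indicator ?C (r *\<^sub>R y) * ?k r \<partial>lborel) \<partial>M)"
  proof (rule nn_integral_mono, rule shell_weight_mult_mono)
    fix y assume y: "N y > 0"
    define b where "b = a / N y"
    have b: "b \<ge> 0" using a y by (simp add: b_def)
    \<comment> \<open>Membership is tested at the old radius \<open>r\<close>, while the density is
      taken at the shifted radius \<open>r - b\<close>. Translation invariance of Lebesgue measure
      then moves the shift into the indicator.\<close>
    let ?F = "\<lambda>r. indicator C' (r *\<^sub>R y) * ?k (r - b)"
    have "(\<integral>\<^sup>+r. ?J (r *\<^sub>R y) * ?k r \<partial>lborel) \<le> (\<integral>\<^sup>+r. ?F r \<partial>lborel)"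
    proof (rule nn_integral_mono)
      fix r :: real
      show "?J (r *\<^sub>R y) * ?k r \<le> ?F r"
      proof (cases "r > 0 \<and> r *\<^sub>R y \<in> C'")
        case True
        then have "r * N y > a" using gt[of "r *\<^sub>R y"] by (simp add: N_scale)
        then have br: "b < r" using y by (simp add: b_def field_simps)
        have "(1 + (p + 1) * a / (r * N y)) * r powr (- p - 1) \<le> (r - b) powr (- p - 1)"
          using powr_shift_bernoulli[OF p_pos b br] by (simp add: b_def mult_ac)
        moreover have "0 \<le> 1 + (p + 1) * a / (r * N y)"
          using True a y p_pos by simp
        ultimately show ?thesis
          using True br by (simp add: N_scale ennreal_leI flip: ennreal_mult)
      qed (auto simp: indicator_def)
    qed
    also have "\<dots> = (\<integral>\<^sup>+s. ?F (b + 1 * s) \<partial>lborel)"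
      by (subst nn_integral_real_affine[where c=1 and t=b]) simp_all
    also have "\<dots> \<le> (\<integral>\<^sup>+s. indicator ?C (s *\<^sub>R y) * ?k s \<partial>lborel)"
    proof (rule nn_integral_mono)
      fix s :: real
      show "?F (b + 1 * s) \<le> indicator ?C (s *\<^sub>R y) * ?k s"
      proof (cases "s > 0 \<and> (b + s) *\<^sub>R y \<in> C'")
        case True
        then have bs: "b + s > 0" using b by simp
        have "a / ((b + s) * N y) * (b + s) = b" using bs y by (simp add: b_def)
        then have "(b + s) *\<^sub>R y - (a / N ((b + s) *\<^sub>R y)) *\<^sub>R ((b + s) *\<^sub>R y) = s *\<^sub>R y"
          using bs by (simp only: N_scale scaleR_scaleR) (simp add: scaleR_add_left)
        then have "s *\<^sub>R y \<in> C" using shift[of "(b + s) *\<^sub>R y"] True by simp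
        then show ?thesis using True y by (simp add: N_scale)
      qed (auto simp: indicator_def)
    qed
    finally show "(\<integral>\<^sup>+r. ?J (r *\<^sub>R y) * ?k r \<partial>lborel) \<le> (\<integral>\<^sup>+r. indicator ?C (r *\<^sub>R y) * ?k r \<partial>lborel)" .
  qed
  also have "\<dots> = (\<integral>\<^sup>+x. indicator ?C x \<partial>M)"
    by (intro nn_integral_rays[symmetric]) auto
  also have "\<dots> = emeasure M ?C" by simp
  also have "\<dots> \<le> emeasure M C" by (intro emeasure_mono) (auto simp: sets_M)
  finally show ?thesis .
qed

text \<open>The product of \<open>indicator U - indicator E\<close> with
  \<open>1 / N - 1 / m\<close> is pointwise non-negative. As the two masses agree, its integral is
  the difference of the two integrals of \<open>1 / N\<close>, which is at most 0. Hence it vanishes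
  almost everywhere, and the sets can differ only on the null level set
  \<open>N = m\<close>.\<close>

lemma bathtub_equality:
  assumes [measurable]: "U \<in> sets borel" and U: "\<And>x. x \<in> U \<Longrightarrow> N x > 0" and m: "m > 0"
    and E: "E = {x. N x \<ge> m}" and eq: "emeasure M U = emeasure M E" and fin: "emeasure M E < \<infinity>"
    and le: "(\<integral>\<^sup>+x. ennreal (1 / N x) * indicator U x \<partial>M) \<le> (\<integral>\<^sup>+x. ennreal (1 / N x) * indicator E x \<partial>M)"
  shows "sym_diff U E \<in> null_sets M"
proof -
  have [measurable]: "E \<in> sets borel" unfolding E by measurable
  \<comment> \<open>Finiteness permits passing to Bochner integrals, where differences can be
    formed.\<close>
  have finE: "(\<integral>\<^sup>+x. ennreal (1 / N x) * indicator E x \<partial>M) < \<infinity>"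
    using nn_integral_inverse_N_tail[OF m] fin by (simp add: E ennreal_mult_less_top)
  have nn: "(\<integral>\<^sup>+x. ennreal (indicator V x / N x) \<partial>M) = (\<integral>\<^sup>+x. ennreal (1 / N x) * indicator V x \<partial>M)" for V
    by (intro nn_integral_cong) (auto simp: indicator_def)
  have int: "integrable M (\<lambda>x. 1 / N x * indicator V x)"
    if [measurable]: "V \<in> sets borel" and "(\<integral>\<^sup>+x. ennreal (1 / N x) * indicator V x \<partial>M) < \<infinity>" for V
    using that(2) N_nonneg by (intro integrableI_nonneg) (auto simp: nn)
  have int_eq: "ennreal (\<integral>x. 1 / N x * indicator V x \<partial>M) = (\<integral>\<^sup>+x. ennreal (1 / N x) * indicator V x \<partial>M)"
    if "integrable M (\<lambda>x. 1 / N x * indicator V x)" for V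
    using nn_integral_eq_integral[OF that] N_nonneg by (simp add: nn)
  have iE: "integrable M (\<lambda>x. 1 / N x * indicator E x)" by (rule int[OF _ finE]) measurable
  have iU: "integrable M (\<lambda>x. 1 / N x * indicator U x)"
    by (rule int[OF _ le_less_trans[OF le finE]]) measurable
  have jE: "integrable M (indicator E :: _ \<Rightarrow> real)" and jU: "integrable M (indicator U :: _ \<Rightarrow> real)"
    using fin eq by (auto intro!: integrable_real_indicator simp: sets_M)
  define f where "f x = (indicator U x - indicator E x) * (1 / N x - 1 / m)" for x
  have f_eq: "f = (\<lambda>x. (1 / N x * indicator U x - 1 / N x * indicator E x) - 1 / m * (indicator U x - indicator E x))"
    by (auto simp: f_def algebra_simps)
  have f_int: "integrable M f" unfolding f_eq using iE iU jE jU by auto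
  \<comment> \<open>Positivity of \<open>N\<close> on \<open>U\<close> matters here: at a zero of
    \<open>N\<close> the convention \<open>1 / 0 = 0\<close> would make the second factor
    negative.\<close>
  have f_nn: "f x \<ge> 0" for x
    using U[of x] m by (auto simp: f_def E indicator_def field_simps)
  have "ennreal (\<integral>x. 1 / N x * indicator U x \<partial>M) \<le> ennreal (\<integral>x. 1 / N x * indicator E x \<partial>M)"
    using le int_eq[OF iE] int_eq[OF iU] by simp
  then have "(\<integral>x. 1 / N x * indicator U x \<partial>M) \<le> (\<integral>x. 1 / N x * indicator E x \<partial>M)"
    using N_nonneg by (subst (asm) ennreal_le_iff) (auto intro!: integral_nonneg_AE)
  moreover have "integral\<^sup>L M f = ((\<integral>x. 1 / N x * indicator U x \<partial>M) - (\<integral>x. 1 / N x * indicator E x \<partial>M))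
      - 1 / m * ((\<integral>x. indicator U x \<partial>M) - (\<integral>x. indicator E x \<partial>M))"
    unfolding f_eq using iE iU jE jU by simp
  moreover have "(\<integral>x. indicator U x \<partial>M) = (\<integral>x. indicator E x \<partial>M :: real)"
    using eq by (simp add: measure_def space_M)
  ultimately have "integral\<^sup>L M f \<le> 0" by simp
  then have "integral\<^sup>L M f = 0" using f_nn by (intro antisym integral_nonneg) auto
  then have "AE x in M. f x = 0"
    using integral_nonneg_eq_0_iff_AE[OF f_int] f_nn by simp
  moreover have "AE x in M. N x \<noteq> m"
    using emeasure_level_set[OF m] by (intro AE_I[of _ _ "{x. N x = m}"]) (auto simp: sets_M)
  ultimately have "AE x in M. x \<notin> sym_diff U E"
  proof eventually_elim
    case (elim x)
    then show ?case using U[of x] m by (auto simp: f_def E indicator_def split: if_splits)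
  qed
  moreover have "sym_diff U E \<in> sets M" by (simp add: sets_M)
  ultimately show ?thesis by (simp add: AE_iff_null_sets)
qed

text \<open>A ball around the origin of finite mass \<open>k\<close> would have dilates of mass
  \<open>n powr (- p) * k\<close>, tending to 0. These dilates exhaust the space, so the whole
  measure would be zero.\<close>

lemma emeasure_open_zero:
  assumes "open U" "0 \<in> U" "emeasure M UNIV \<noteq> 0"
  shows "emeasure M U = \<infinity>"
proof (rule ccontr)
  assume fin: "emeasure M U \<noteq> \<infinity>"
  obtain d where d: "d > 0" "ball 0 d \<subseteq> U" using assms open_contains_ball by blast
  define K where "K = emeasure M (ball 0 d)"
  have "K \<le> emeasure M U" unfolding K_def using d assms by (intro emeasure_mono) (auto simp: sets_M)
  then have "K < \<infinity>" using fin by (auto simp: top_unique less_top)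
  then obtain k where k: "K = ennreal k" "k \<ge> 0" by (cases K) auto
  let ?b = "\<lambda>n. ball (0::'a) (real (Suc n) * d)"
  have b: "emeasure M (?b n) = ennreal (real (Suc n) powr (- p) * k)" for n
  proof -
    have "?b n = (*\<^sub>R) (real (Suc n)) ` ball 0 d"
      using ball_scale[of "real (Suc n)" "0::'a" d] by (simp del: of_nat_Suc)
    then show ?thesis
      using emeasure_scale[of "ball 0 d" "real (Suc n)"] k by (simp add: K_def ennreal_mult)
  qed
  have "(\<Union>n. ?b n) = UNIV"
  proof (intro equalityI subsetI UNIV_I)
    fix x :: 'a
    obtain n where "norm x < real n * d" using ex_less_of_nat_mult[OF d(1)] by blast
    also have "\<dots> \<le> real (Suc n) * d" using d by (intro mult_right_mono) auto
    finally show "x \<in> (\<Union>n. ?b n)" by auto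
  qed
  moreover have "incseq ?b" using d by (intro incseq_SucI subset_ball mult_right_mono) auto
  moreover have "range ?b \<subseteq> sets M" by (auto simp: sets_M)
  ultimately have "(\<lambda>n. emeasure M (?b n)) \<longlonglongrightarrow> emeasure M UNIV"
    using Lim_emeasure_incseq[of ?b M] by metis
  moreover have "(\<lambda>n. ennreal (real (Suc n) powr (- p) * k)) \<longlonglongrightarrow> ennreal (0 * k)"
    using p_pos by (intro tendsto_ennrealI tendsto_mult tendsto_const tendsto_neg_powr
      filterlim_compose[OF filterlim_real_sequentially filterlim_Suc]) auto
  ultimately have "emeasure M UNIV = 0" using LIMSEQ_unique unfolding b by fastforce
  then show False using assms by simp
qed

end

section \<open>Erosions and the lower bound for the inner boundary measure\<close>

locale homogeneous_measure_convex = homogeneous_measure M p "gauge_of B"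
  for M :: "'a::euclidean_space measure" and p B +
  assumes B: "open B" "convex B" "0 \<in> B"
    and nontrivial: "emeasure M UNIV \<noteq> 0"
begin

abbreviation N where "N \<equiv> gauge_of B"

text \<open>The erosion of morphology: the points \<open>x\<close> for which the whole of
  \<open>x - \<epsilon> B\<close> stays in \<open>C\<close>. What it removes from \<open>C\<close>
  is the layer measured by the inner boundary measure.\<close>

definition erosion :: "real \<Rightarrow> 'a set \<Rightarrow> 'a set" where
  "erosion \<epsilon> C = C - ((UNIV - C) + (*\<^sub>R) \<epsilon> ` B)"

lemma erosionD:
  assumes "x \<in> erosion \<epsilon> C" "b \<in> B"
  shows "x - \<epsilon> *\<^sub>R b \<in> C"
proof (rule ccontr)
  assume "x - \<epsilon> *\<^sub>R b \<notin> C"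
  then have "(x - \<epsilon> *\<^sub>R b) + \<epsilon> *\<^sub>R b \<in> (UNIV - C) + (*\<^sub>R) \<epsilon> ` B"
    using assms by (intro set_plus_intro) auto
  then show False using assms by (simp add: erosion_def)
qed

lemma erosion_antimono:
  assumes "0 < s" "s \<le> t"
  shows "erosion t C \<subseteq> erosion s C"
  unfolding erosion_def using set_plus_mono2[OF order_refl convex_scale_mono[OF B(2,3) assms]] by (rule Diff_mono[OF order_refl])

lemma erosion_measurable [measurable]:
  assumes "C \<in> sets borel" "\<epsilon> > 0"
  shows "erosion \<epsilon> C \<in> sets borel"
proof -
  have "open ((UNIV - C) + (*\<^sub>R) \<epsilon> ` B)"
  proof -
    have "(UNIV - C) + (*\<^sub>R) \<epsilon> ` B = (\<Union>x\<in>UNIV - C. (+) x ` (*\<^sub>R) \<epsilon> ` B)"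
      by (auto simp: set_plus_def)
    then show ?thesis
      using B assms by (auto intro!: open_translation open_scaling)
  qed
  then show ?thesis using assms by (simp add: erosion_def)
qed

text \<open>If \<open>N x < \<epsilon>\<close>, then \<open>x - \<epsilon> B\<close> is an open
  neighbourhood of the origin, hence of infinite measure, yet it is contained in
  \<open>C\<close>.\<close>

lemma erosion_N_ge:
  assumes x: "x \<in> erosion \<epsilon> C" and "\<epsilon> > 0" "C \<in> sets borel" "emeasure M C < \<infinity>"
  shows "N x \<ge> \<epsilon>"
proof (rule ccontr)
  assume "\<not> N x \<ge> \<epsilon>"
  then have "x \<in> (*\<^sub>R) \<epsilon> ` B" using gauge_of_lt_iff[OF B assms(2)] by (simp add: not_le)
  then obtain b where b: "b \<in> B" "x = \<epsilon> *\<^sub>R b" by auto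
  let ?U = "(\<lambda>z. x - z) ` (*\<^sub>R) \<epsilon> ` B"
  have "?U = (+) x ` (*\<^sub>R) (- \<epsilon>) ` B" by (auto simp: image_image)
  then have "open ?U" using B(1) assms(2) by (simp only:) (intro open_translation open_scaling, auto)
  moreover have "0 \<in> ?U" using b by auto
  ultimately have "emeasure M ?U = \<infinity>" using emeasure_open_zero nontrivial by blast
  moreover have "emeasure M ?U \<le> emeasure M C"
    using erosionD[OF x] assms by (intro emeasure_mono) (auto simp: sets_M)
  ultimately show False using assms by (auto simp: top_unique)
qed

text \<open>The point \<open>x / N x\<close> has gauge 1 and so lies outside the open set
  \<open>B\<close>. The radial shift is therefore applied with \<open>a = t * \<epsilon>\<close> for
  \<open>t < 1\<close>, where \<open>(t / N x) x\<close> does belong to \<open>B\<close>, and then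
  \<open>t\<close> tends to 1.\<close>

lemma emeasure_erosion_le:
  assumes eps: "\<epsilon> > 0" and [measurable]: "C \<in> sets borel" and fin: "emeasure M C < \<infinity>"
  shows "emeasure M (erosion \<epsilon> C)
      + ennreal ((p + 1) * \<epsilon>) * (\<integral>\<^sup>+x. ennreal (1 / N x) * indicator (erosion \<epsilon> C) x \<partial>M)
    \<le> emeasure M C"
proof -
  define C' where "C' = erosion \<epsilon> C"
  have [measurable]: "C' \<in> sets borel" unfolding C'_def using eps by measurable
  define I where "I = (\<integral>\<^sup>+x. ennreal (1 / N x) * indicator C' x \<partial>M)"
  have N_ge: "N x \<ge> \<epsilon>" if "x \<in> C'" for x
    using erosion_N_ge that eps fin assms unfolding C'_def by blast
  have t: "emeasure M C' + ennreal ((p + 1) * (t * \<epsilon>)) * I \<le> emeasure M C" if t: "0 < t" "t < 1" for t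
  proof -
    have "emeasure M C' + ennreal ((p + 1) * (t * \<epsilon>)) * I
        = (\<integral>\<^sup>+x. indicator C' x + ennreal ((p + 1) * (t * \<epsilon>)) * (ennreal (1 / N x) * indicator C' x) \<partial>M)"
      unfolding I_def by (subst nn_integral_add) (auto simp: nn_integral_cmult)
    also have "\<dots> = (\<integral>\<^sup>+x. ennreal (1 + (p + 1) * (t * \<epsilon>) / N x) * indicator C' x \<partial>M)"
      using p_pos t eps N_nonneg
      by (intro nn_integral_cong) (auto simp: indicator_def simp flip: ennreal_mult)
    also have "\<dots> \<le> emeasure M C"
    proof (rule radial_shift_bound)
      fix x assume x: "x \<in> C'"
      have pos: "N x > 0" using N_ge[OF x] eps by simp
      have "t * \<epsilon> < \<epsilon>" using t eps by simp
      then show "N x > t * \<epsilon>" using N_ge[OF x] by simp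
      define b where "b = (t / N x) *\<^sub>R x"
      have "N b < 1" using t pos by (simp add: b_def N_scale)
      then have "b \<in> B" using gauge_of_lt_iff[OF B, of 1 b] by simp
      then show "x - (t * \<epsilon> / N x) *\<^sub>R x \<in> C"
        using erosionD[of x \<epsilon> C b] x by (simp add: C'_def b_def mult.commute)
    qed (use t eps in auto)
    finally show ?thesis .
  qed
  obtain c where c: "emeasure M C = ennreal c" "c \<ge> 0" using fin by (cases "emeasure M C") auto
  have "emeasure M C' \<le> emeasure M C" by (intro emeasure_mono) (auto simp: sets_M C'_def erosion_def)
  then obtain d where d: "emeasure M C' = ennreal d" "d \<ge> 0" using fin by (cases "emeasure M C'") auto
  have pe: "(p + 1) * \<epsilon> > 0" using p_pos eps by simp
  \<comment> \<open>One admissible value of \<open>t\<close> suffices to see that \<open>I\<close>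
    is finite, which allows real arithmetic.\<close>
  have "ennreal ((p + 1) * (1/2 * \<epsilon>)) * I \<le> emeasure M C"
    using t[of "1/2"] by (auto intro: order_trans[rotated])
  then have "I \<noteq> \<infinity>" using fin p_pos eps by (auto simp: ennreal_mult_top split: if_splits)
  then obtain i where i: "I = ennreal i" "i \<ge> 0" by (cases I) auto
  have "(p + 1) * \<epsilon> * i \<le> c - d"
  \<comment> \<open>This rule carries out the limit of \<open>t\<close> to 1.\<close>
  proof (rule field_le_mult_one_interval)
    fix t :: real assume t01: "0 < t" "t < 1"
    have "ennreal (d + (p + 1) * (t * \<epsilon>) * i) \<le> ennreal c"
      using t[OF t01] c d i t01 pe p_pos eps by (simp add: ennreal_mult)
    then show "t * ((p + 1) * \<epsilon> * i) \<le> c - d"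
      using c by (simp add: algebra_simps)
  qed
  then have "ennreal (d + (p + 1) * \<epsilon> * i) \<le> ennreal c" by (intro ennreal_leI) simp
  then show ?thesis using c d i pe by (simp add: ennreal_mult I_def C'_def)
qed

lemma enlargement_quotient_ge:
  assumes eps: "\<epsilon> > 0" and [measurable]: "C \<in> sets borel" and fin: "emeasure M C < \<infinity>"
  shows "ennreal (p + 1) * (\<integral>\<^sup>+x. ennreal (1 / N x) * indicator (erosion \<epsilon> C) x \<partial>M)
    \<le> emeasure M (C - erosion \<epsilon> C) / ennreal \<epsilon>"
proof -
  let ?I = "\<integral>\<^sup>+x. ennreal (1 / N x) * indicator (erosion \<epsilon> C) x \<partial>M"
  have [measurable]: "erosion \<epsilon> C \<in> sets borel" using eps by measurable
  have sub: "erosion \<epsilon> C \<subseteq> C" by (auto simp: erosion_def)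
  then have "emeasure M (erosion \<epsilon> C) \<le> emeasure M C" by (intro emeasure_mono) (auto simp: sets_M)
  then have fin': "emeasure M (erosion \<epsilon> C) \<noteq> \<infinity>" using fin by (auto simp: top_unique)
  have "emeasure M (erosion \<epsilon> C) + emeasure M (C - erosion \<epsilon> C) = emeasure M C"
    using sub by (subst plus_emeasure) (auto simp: sets_M Un_absorb1)
  then have "ennreal ((p + 1) * \<epsilon>) * ?I \<le> emeasure M (C - erosion \<epsilon> C)"
    using emeasure_erosion_le[OF assms] fin'
    by (metis ennreal_add_left_cancel_le infinity_ennreal_def)
  then have "ennreal ((p + 1) * \<epsilon>) * ?I / ennreal \<epsilon> \<le> emeasure M (C - erosion \<epsilon> C) / ennreal \<epsilon>"
    by (rule divide_right_mono_ennreal)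
  moreover have "ennreal ((p + 1) * \<epsilon>) * ?I = (ennreal (p + 1) * ?I) * ennreal \<epsilon>"
    using p_pos eps by (simp add: ennreal_mult mult_ac)
  ultimately show ?thesis
    using eps by (simp add: ennreal_mult_divide_eq)
qed

text \<open>\<open>U\<close> is the union of the erosions. Points of \<open>C\<close> outside
  \<open>U\<close> lie in every layer, so positive mass there would make the quotients blow up,
  against the finite value \<open>L\<close>. The bound on each erosion passes to the lower limit,
  and monotone convergence extends it to \<open>U\<close>. The gauge is positive on
  \<open>U\<close>, unlike possibly on \<open>C\<close>.\<close>

lemma inner_boundary_measure_ge:
  assumes [measurable]: "C \<in> sets borel" and fin: "emeasure M C < \<infinity>"
    and L: "inner_boundary_measure M B C = ennreal L"
  obtains U where "U \<in> sets borel" "U \<subseteq> C" "C - U \<in> null_sets M" "\<And>x. x \<in> U \<Longrightarrow> N x > 0"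
    "ennreal (p + 1) * (\<integral>\<^sup>+x. ennreal (1 / N x) * indicator U x \<partial>M) \<le> ennreal L"
proof -
  define e where "e n = 1 / real (Suc n)" for n
  have e_pos: "e n > 0" for n by (simp add: e_def)
  have L_eq: "Liminf (at_right 0) (\<lambda>\<epsilon>. emeasure M (C - erosion \<epsilon> C) / ennreal \<epsilon>) = ennreal L"
  proof -
    have "C - erosion \<epsilon> C = ((UNIV - C) + (*\<^sub>R) \<epsilon> ` B) - (UNIV - C)" for \<epsilon>
      by (auto simp: erosion_def)
    then show ?thesis using L by (simp add: inner_boundary_measure_def Let_def)
  qed
  define U where "U = (\<Union>n. erosion (e n) C)"
  have em [measurable]: "erosion (e n) C \<in> sets borel" for n using e_pos by measurable
  have U_meas [measurable]: "U \<in> sets borel" unfolding U_def by measurable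
  have U_sub: "U \<subseteq> C" by (auto simp: U_def erosion_def)
  have U_pos: "N x > 0" if "x \<in> U" for x
    using that erosion_N_ge[OF _ e_pos assms(1) fin] e_pos unfolding U_def
    by (meson UN_E less_le_trans)
  have null: "emeasure M (C - U) = 0"
  proof -
    define c where "c = emeasure M (C - U)"
    have "c \<le> emeasure M C" unfolding c_def by (intro emeasure_mono) (auto simp: sets_M)
    then obtain k where k: "c = ennreal k" "k \<ge> 0" using fin by (cases c) auto
    have bound: "ennreal (real n * k) \<le> ennreal L" for n
    proof -
      have "eventually (\<lambda>\<epsilon>. ennreal (real n * k) \<le> emeasure M (C - erosion \<epsilon> C) / ennreal \<epsilon>) (at_right 0)"
      proof (rule eventually_at_rightI[of 0 "1 / real (Suc n)"])
        fix \<epsilon> :: real assume eps: "\<epsilon> \<in> {0<..<1 / real (Suc n)}"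
        obtain j where "e j < \<epsilon>" using eps nat_approx_posE[of \<epsilon>] unfolding e_def by auto
        then have "erosion \<epsilon> C \<subseteq> U" using erosion_antimono[OF e_pos, of j \<epsilon> C] by (auto simp: U_def)
        then have "c \<le> emeasure M (C - erosion \<epsilon> C)"
          unfolding c_def using eps by (intro emeasure_mono) (auto simp: sets_M)
        then have "c / ennreal \<epsilon> \<le> emeasure M (C - erosion \<epsilon> C) / ennreal \<epsilon>"
          by (rule divide_right_mono_ennreal)
        \<comment> \<open>Since \<open>n * \<epsilon> \<le> 1\<close>, the quotient by
          \<open>\<epsilon>\<close> is at least \<open>n\<close> times the mass.\<close>
        moreover have "ennreal (real n * k) \<le> c / ennreal \<epsilon>"
        proof -
          have "real n * \<epsilon> \<le> 1"
            using eps mult_right_mono[of "real n" "real (Suc n)" \<epsilon>] by (simp add: field_simps)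
          then have "(real n * \<epsilon>) * k \<le> 1 * k" using k by (intro mult_right_mono)
          then have "real n * k \<le> k / \<epsilon>" using eps by (simp add: field_simps)
          then show ?thesis using eps k by (simp add: divide_ennreal ennreal_leI)
        qed
        ultimately show "ennreal (real n * k) \<le> emeasure M (C - erosion \<epsilon> C) / ennreal \<epsilon>" by simp
      qed simp
      from Liminf_bounded[OF this] show ?thesis by (simp only: L_eq)
    qed
    have "k = 0"
    proof (rule ccontr)
      assume "k \<noteq> 0"
      \<comment> \<open>The maximum covers a negative \<open>L\<close>, which \<open>ennreal\<close>
        truncates to 0.\<close>
      then obtain n where "max L 0 < real n * k" using ex_less_of_nat_mult[of k "max L 0"] k by auto
      then show False using bound[of n] by (auto simp: ennreal_le_iff2)
    qed
    then show ?thesis using k by (simp add: c_def)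
  qed
  let ?I = "\<lambda>V. \<integral>\<^sup>+x. ennreal (1 / N x) * indicator V x \<partial>M"
  have le: "ennreal (p + 1) * ?I (erosion (e n) C) \<le> ennreal L" for n
  proof -
    have "eventually (\<lambda>\<epsilon>. ennreal (p + 1) * ?I (erosion (e n) C) \<le> emeasure M (C - erosion \<epsilon> C) / ennreal \<epsilon>) (at_right 0)"
    proof (rule eventually_at_rightI[of 0 "e n"])
      fix \<epsilon> assume eps: "\<epsilon> \<in> {0<..<e n}"
      \<comment> \<open>The domain of integration is frozen at \<open>e n\<close> while
        \<open>\<epsilon>\<close> decreases, so that the lower bound is constant when the lower
        limit is taken.\<close>
      have "erosion (e n) C \<subseteq> erosion \<epsilon> C" using eps by (intro erosion_antimono) auto
      then have "?I (erosion (e n) C) \<le> ?I (erosion \<epsilon> C)"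
        by (intro nn_integral_mono mult_left_mono) (auto simp: indicator_def)
      then have "ennreal (p + 1) * ?I (erosion (e n) C) \<le> ennreal (p + 1) * ?I (erosion \<epsilon> C)"
        by (intro mult_left_mono) auto
      also have "\<dots> \<le> emeasure M (C - erosion \<epsilon> C) / ennreal \<epsilon>"
        using eps fin by (intro enlargement_quotient_ge) auto
      finally show "ennreal (p + 1) * ?I (erosion (e n) C) \<le> emeasure M (C - erosion \<epsilon> C) / ennreal \<epsilon>" .
    qed (rule e_pos)
    from Liminf_bounded[OF this] show ?thesis by (simp only: L_eq)
  qed
  have inc: "incseq (\<lambda>n. erosion (e n) C)"
    by (intro incseq_SucI erosion_antimono e_pos) (auto simp: e_def field_simps)
  have "?I U = (\<integral>\<^sup>+x. (SUP n. ennreal (1 / N x) * indicator (erosion (e n) C) x) \<partial>M)"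
  proof (intro nn_integral_cong)
    fix x
    have "(indicator U x :: ennreal) = (SUP n. indicator (erosion (e n) C) x)"
    proof (cases "x \<in> U")
      case True
      then obtain n where "x \<in> erosion (e n) C" by (auto simp: U_def)
      then show ?thesis by (intro antisym SUP_upper2[of n] SUP_least) (auto simp: indicator_def U_def)
    qed (auto simp: U_def)
    then show "ennreal (1 / N x) * indicator U x = (SUP n. ennreal (1 / N x) * indicator (erosion (e n) C) x)"
      by (simp add: SUP_mult_left_ennreal)
  qed
  also have "\<dots> = (SUP n. ?I (erosion (e n) C))"
  proof (rule nn_integral_monotone_convergence_SUP)
    show "incseq (\<lambda>n x. ennreal (1 / N x) * indicator (erosion (e n) C) x)"
      using incseqD[OF inc] by (auto simp: incseq_def le_fun_def indicator_def)
  qed measurable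
  finally have "ennreal (p + 1) * ?I U = (SUP n. ennreal (p + 1) * ?I (erosion (e n) C))"
    by (simp add: SUP_mult_left_ennreal)
  also have "\<dots> \<le> ennreal L" using le by (rule SUP_least)
  finally show ?thesis using that[of U] U_meas U_sub U_pos null by (auto simp: null_sets_def sets_M)
qed

end

section \<open>Comparison with the superlevel set in the equality case\<close>

theorem theorem4p10:
  fixes \<mu> :: "(real ^ 'n) measure" and \<Sigma> B C :: "(real ^ 'n) set" and q :: real
  assumes "q < 0"
    and "sets \<mu> = sets borel" and "sigma_finite_measure \<mu>"
    and "q_homogeneous q \<mu>"
    and "\<Sigma> \<in> sets borel" and "dilation_cone \<Sigma>" and "supported_on \<mu> \<Sigma>"
    and "domain_set B" and "convex B" and "0 \<in> B"
    and "0 < emeasure \<mu> (UNIV - B)" and "emeasure \<mu> (UNIV - B) < \<infinity>"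
    and "C \<in> sets borel"
    and "0 < emeasure \<mu> C" and "emeasure \<mu> C < \<infinity>"
    and "inner_boundary_measure \<mu> B C =
           ennreal (- (1 / q) * measure \<mu> (UNIV - B) powr q * measure \<mu> C powr (1 - q))"
  shows "\<exists>m>0. (*\<^sub>R) m ` (\<Sigma> - B) = \<Sigma> - (*\<^sub>R) m ` B \<and>
           sym_diff (C \<inter> \<Sigma>) ((*\<^sub>R) m ` (\<Sigma> - B)) \<in> null_sets \<mu>"
proof -
  define p where "p = - (1 / q)"
  have p: "p > 0" using assms(1) by (simp add: p_def)
  have B: "open B" "convex B" "0 \<in> B" using assms(8-10) by (auto simp: domain_set_def)
  have homog: "emeasure \<mu> ((*\<^sub>R) l ` A) = ennreal (l powr (- p)) * emeasure \<mu> A"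
    if "A \<in> sets borel" "l > 0" for A l
    using assms(4) that by (simp add: q_homogeneous_def p_def)
  have "emeasure \<mu> (UNIV - B) \<le> emeasure \<mu> UNIV"
    using assms(2) by (intro emeasure_mono) auto
  then have nontrivial: "emeasure \<mu> UNIV \<noteq> 0" using assms(11) by auto
  interpret sigma_finite_measure \<mu> by fact
  interpret homogeneous_measure_convex \<mu> p B
    by unfold_locales (fact assms(2) p homog B nontrivial gauge_of_measurable[OF B]
      gauge_of_nonneg[OF B] gauge_of_scaleR[OF B])+
  define b where "b = measure \<mu> (UNIV - B)"
  define c where "c = measure \<mu> C"
  have b: "emeasure \<mu> (UNIV - B) = ennreal b" "b > 0"
    using assms(11,12) by (simp_all add: b_def measure_def enn2real_positive_iff less_top)
  have c: "emeasure \<mu> C = ennreal c" "c > 0"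
    using assms(14,15) by (simp_all add: c_def measure_def enn2real_positive_iff less_top)
  \<comment> \<open>The factor is forced by the masses: the complement of \<open>m B\<close> has
    measure \<open>m powr (- p) * b\<close>, which must equal \<open>c\<close>.\<close>
  define m where "m = (b / c) powr (1 / p)"
  have m: "m > 0" using b c by (simp add: m_def)
  have scale: "(*\<^sub>R) m ` (S - B) = (*\<^sub>R) m ` S - (*\<^sub>R) m ` B" for S
    using m by (intro image_set_diff) (simp add: inj_on_def)
  have surj: "(*\<^sub>R) m ` (UNIV :: (real ^ 'n) set) = UNIV"
    using m by (auto simp: scaleR_image_iff)
  have homothety: "(*\<^sub>R) m ` (\<Sigma> - B) = \<Sigma> - (*\<^sub>R) m ` B"
    using assms(6) m by (simp add: scale dilation_cone_def)
  define E where "E = {x. N x \<ge> m}"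
  have E: "E = (*\<^sub>R) m ` (UNIV - B)"
    using gauge_of_lt_iff[OF B m] by (auto simp: E_def scale surj not_less[symmetric])
  have "m powr (- p) = c / b"
    using p b c by (simp add: m_def powr_powr powr_minus_divide)
  then have emE: "emeasure \<mu> E = ennreal c"
    using homog[of "UNIV - B" m] m B b c by (simp add: E flip: ennreal_mult)
  define L where "L = - (1 / q) * b powr q * c powr (1 - q)"
  \<comment> \<open>As \<open>1 / p = - q\<close>, the inverse of \<open>m\<close> is
    \<open>(b / c) powr q\<close>, whence \<open>L = p * c / m\<close>. The form stated is
    \<open>p + 1\<close> times the integral of \<open>1 / N\<close> over \<open>E\<close>.\<close>
  have L: "L = (p + 1) * (p / ((p + 1) * m) * c)"
  proof -
    have "1 / m = (b / c) powr q" using assms(1) b c by (simp add: m_def p_def powr_minus_divide)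
    also have "\<dots> = b powr q / c powr q" using b c by (simp add: powr_divide)
    finally have "c * (1 / m) = b powr q * c powr (1 - q)" using c by (simp only: powr_diff) simp
    then have "L = p * (c * (1 / m))" by (simp only: L_def p_def mult.assoc)
    moreover have "p + 1 \<noteq> 0" using p by simp
    ultimately show ?thesis by simp
  qed
  obtain U where U: "U \<in> sets borel" "U \<subseteq> C" "C - U \<in> null_sets \<mu>" "\<And>x. x \<in> U \<Longrightarrow> N x > 0"
    and le: "ennreal (p + 1) * (\<integral>\<^sup>+x. ennreal (1 / N x) * indicator U x \<partial>\<mu>) \<le> ennreal L"
    using inner_boundary_measure_ge[OF assms(13,15), of L] assms(16) unfolding L_def b_def c_def by blast
  have "emeasure \<mu> U = emeasure \<mu> (C - (C - U))" using U(2) by (simp add: double_diff)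
  also have "\<dots> = emeasure \<mu> C"
    using U assms(2,13) by (intro emeasure_Diff_null_set) auto
  finally have emU: "emeasure \<mu> U = emeasure \<mu> E" using c emE by simp
  have "ennreal (p + 1) * (\<integral>\<^sup>+x. ennreal (1 / N x) * indicator U x \<partial>\<mu>)
      \<le> ennreal (p + 1) * (\<integral>\<^sup>+x. ennreal (1 / N x) * indicator E x \<partial>\<mu>)"
  proof -
    have "(\<integral>\<^sup>+x. ennreal (1 / N x) * indicator E x \<partial>\<mu>) = ennreal (p / ((p + 1) * m) * c)"
      using nn_integral_inverse_N_tail[OF m] emE p m c by (subst ennreal_mult) (auto simp: E_def)
    then have "ennreal L = ennreal (p + 1) * (\<integral>\<^sup>+x. ennreal (1 / N x) * indicator E x \<partial>\<mu>)"
      unfolding L using p m c by (simp only:) (intro ennreal_mult, auto)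
    then show ?thesis using le by simp
  qed
  then have "(\<integral>\<^sup>+x. ennreal (1 / N x) * indicator U x \<partial>\<mu>) \<le> (\<integral>\<^sup>+x. ennreal (1 / N x) * indicator E x \<partial>\<mu>)"
    using p by (subst (asm) ennreal_mult_le_mult_iff) auto
  then have "sym_diff U E \<in> null_sets \<mu>"
    using U(1,4) m E_def emU emE by (intro bathtub_equality[where m=m]) auto
  then have "sym_diff U E \<union> (C - U) \<in> null_sets \<mu>" using U(3) by blast
  \<comment> \<open>Within \<open>\<Sigma>\<close> the set \<open>\<Sigma> - m B\<close> coincides
    with \<open>E\<close>, and \<open>C\<close> differs from \<open>U\<close> only by
    \<open>C - U\<close>.\<close>
  moreover have "sym_diff (C \<inter> \<Sigma>) (\<Sigma> - (*\<^sub>R) m ` B) \<subseteq> sym_diff U E \<union> (C - U)"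
    using U(2) by (auto simp: E scale surj)
  moreover have "sym_diff (C \<inter> \<Sigma>) (\<Sigma> - (*\<^sub>R) m ` B) \<in> sets \<mu>"
  proof -
    have "open ((*\<^sub>R) m ` B)" using B m by (intro open_scaling) auto
    then have "(*\<^sub>R) m ` B \<in> sets borel" by simp
    then show ?thesis using assms(2,5,13) by simp
  qed
  ultimately have "sym_diff (C \<inter> \<Sigma>) (\<Sigma> - (*\<^sub>R) m ` B) \<in> null_sets \<mu>"
    using null_sets_subset by blast
  then show ?thesis using m homothety by auto
qed

end
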